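(* If $x^*$ satisfies the CAKKT2 conditions for the problem (SOCP) and fulfills Robinson CQ and the weak constant rank (WCR) property, then there exist multipliers $\mu^*\in\mathbb{R}^p$ and $\omega^*\in\mathcal{K}$ such that $x^*$ satisfies the weak second-order necessary condition (WSONC) with $\mu^*$ and $\omega^*$.
   Context: Problem (SOCP): minimize $f(x)$ over $x\in\mathbb{R}^n$ subject to $g_i(x)\in\mathcal{K}_i$ ($i=1,\dots,r$) and $h(x)=0$, where $f:\mathbb{R}^n\to\mathbb{R}$, $h:\mathbb{R}^n\to\mathbb{R}^p$, $g_i:\mathbb{R}^n\to\mathbb{R}^{m_i}$ are twice continuously differentiable. A vector $w\in\mathbb{R}^\ell$ is written $w=(w_0,\overline{w})\in\mathbb{R}\times\mathbb{R}^{\ell-1}$, and $[w]_0:=w_0$. $\mathcal{K}_i:=\{(w_0,\overline w)\in\mathbb{R}\times\mathbb{R}^{m_i-1}\mid w_0\ge\|\overline w\|\}$ if $m_i>1$ and $\mathcal{K}_i:=\{w\in\mathbb{R}\mid w\ge0\}$ if $m_i=1$; $\mathcal{K}:=\mathcal{K}_1\times\dots\times\mathcal{K}_r$, $g:=(g_1,\dots,g_r)$. $\|\cdot\|$ is the Euclidean norm; $D$ denotes the Jacobian (rows are transposed gradients). $\mathrm{int}(\mathcal{K}_i)$ is the set where $w_0>\|\overline w\|$, and $\mathrm{bd}^+(\mathcal{K}_i)$ the set where $w_0=\|\overline w\|\ne0$. For feasible $x$: $I_0(x):=\{i\mid g_i(x)=0\}$, $I_B(x):=\{i\mid g_i(x)\in\mathrm{bd}^+(\mathcal{K}_i)\}$.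 Lagrangian: $L(x,\mu,\omega):=f(x)+\langle h(x),\mu\rangle-\langle g(x),\omega\rangle$ for $\mu\in\mathbb{R}^p$, $\omega=(\omega_1,\dots,\omega_r)\in\mathcal{K}$; $\nabla_x L,\nabla_x^2L$ are its gradient and Hessian in $x$. $(x,\mu,\omega)$ with $\mu\in\mathbb{R}^p$, $\omega\in\mathcal{K}$ is a KKT triple if $x$ is feasible, $\nabla_xL(x,\mu,\omega)=0$ and $\langle g_i(x),\omega_i\rangle=0$ for all $i$. $\Gamma_i:=\begin{pmatrix}1&0^\top\\0&-I_{m_i-1}\end{pmatrix}$, $\tilde g_i(x):=(\|\overline{g_i(x)}\|,\overline{g_i(x)})$, and, relative to $x^*$, $\sigma(x,\omega):=\sum_{i\in I_B(x^* )}-\frac{[\omega_i]_0}{[g_i(x)]_0}Dg_i(x)^\top\Gamma_iDg_i(x)$. Jordan product: $y\circ z:=(\langle y,z\rangle,\,y_0\overline z+z_0\overline y)$. Robinson CQ at a feasible $x$: $Dh(x)$ has full row rank and there is $d\in\mathbb{R}^n$ with $g_i(x)+Dg_i(x)d\in\mathrm{int}(\mathcal{K}_i)$ for all $i$ and $Dh(x)d=0$. WCR property at a feasible $x^*$: there is a neighborhood $\mathcal{N}$ of $x^*$ such that the family $\{\nabla h_i(x)\}_{i=1,\dots,p}\cup\{\nabla g_{ij}(x)\}_{i\in I_0(x^* ),\,j=1,\dots,m_i}\cup\{Dg_i(x)^\top\Gamma_i\tilde g_i(x)\}_{i\in I_B(x^* )}$ has the same rank for all $x\in\mathcal{N}$,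 where $g_{ij}$ is the $j$-th component of $g_i$. WSONC at $x^*$ with multipliers $\mu^*,\omega^*$: $(x^*,\mu^*,\omega^* )$ is a KKT triple and $d^\top(\nabla_x^2L(x^*,\mu^*,\omega^* )+\sigma(x^*,\omega^* ))d\ge0$ for all $d\in S(x^* ):=\{d\in\mathbb{R}^n\mid Dh(x^* )d=0;\ Dg_i(x^* )d=0,\ i\in I_0(x^* );\ g_i(x^* )^\top\Gamma_iDg_i(x^* )d=0,\ i\in I_B(x^* )\}$. CAKKT conditions: sequences $x^k\to x^*$, $\{\mu^k\}\subset\mathbb{R}^p$, $\{\omega^k\}\subset\mathcal{K}$ satisfy the CAKKT conditions at a feasible $x^*$ if $\nabla_xL(x^k,\mu^k,\omega^k)\to0$, $g_i(x^k)\circ\omega_i^k\to0$ for $i=1,\dots,r$, and $h_i(x^k)\mu_i^k\to0$ for $i=1,\dots,p$. CAKKT2 conditions: a feasible point $x^*$ satisfies CAKKT2 if there exist sequences $x^k\to x^*$, $\{\mu^k\}\subset\mathbb{R}^p$, $\{\omega^k\}\subset\mathcal{K}$ satisfying the CAKKT conditions and, in addition, sequences $\{\eta^k\}\subset\mathbb{R}^p$, $\{\theta_i^k\}\subset\mathbb{R}$ ($i\in I_0(x^* )$), $\{\gamma_i^k\}\subset\mathbb{R}$ ($i\in I_B(x^* )$), $\{\delta_k\}\subset\mathbb{R}_+$ with $\delta_k\to0$, such that for all sufficiently large $k$ and all $d\in\mathbb{R}^n$, $$d^\top\Big(\nabla_x^2L(x^k,\mu^k,\omega^k)+\sigma(x^k,\omega^k)+\sum_{i=1}^p\eta_i^k\nabla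 h_i(x^k)\nabla h_i(x^k)^\top+\sum_{i\in I_B(x^* )}\gamma_i^k(Dg_i(x^k)^\top\Gamma_i\tilde g_i(x^k))(Dg_i(x^k)^\top\Gamma_i\tilde g_i(x^k))^\top+\sum_{i\in I_0(x^* )}\theta_i^kDg_i(x^k)^\top Dg_i(x^k)+\delta_kI_n\Big)d\ge0.$$ *)

theory Defs
  imports "HOL-Analysis.Analysis"
begin

(* The block sizes m_i depend on i, so they cannot be types.  A vector of R^l is a function
   nat => real of which only the entries 0, ..., l - 1 are ever inspected, [w]_0 being w 0, and
   a matrix with l rows in R^n is a function nat => real^'n listing its rows.  All index ranges
   are zero-based. *)

section \<open>Vectors of variable length\<close>

definition inner_l :: "nat \<Rightarrow> (nat \<Rightarrow> real) \<Rightarrow> (nat \<Rightarrow> real) \<Rightarrow> real" where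
  "inner_l l y z = (\<Sum>j<l. y j * z j)"

definition tail_norm :: "nat \<Rightarrow> (nat \<Rightarrow> real) \<Rightarrow> real" where
  "tail_norm l w = sqrt (\<Sum>j\<in>{1..<l}. (w j)\<^sup>2)"

(* For l = 1 the tail is empty and has norm 0, so the next three sets are the half-line
   w 0 >= 0, the open half-line w 0 > 0 and the empty set. *)
definition soc :: "nat \<Rightarrow> (nat \<Rightarrow> real) set" where
  "soc l = {w. w 0 \<ge> tail_norm l w}"

definition soc_int :: "nat \<Rightarrow> (nat \<Rightarrow> real) set" where
  "soc_int l = {w. w 0 > tail_norm l w}"

definition soc_bd_plus :: "nat \<Rightarrow> (nat \<Rightarrow> real) set" where
  "soc_bd_plus l = {w. w 0 = tail_norm l w \<and> tail_norm l w \<noteq> 0}"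

definition jordan_prod :: "nat \<Rightarrow> (nat \<Rightarrow> real) \<Rightarrow> (nat \<Rightarrow> real) \<Rightarrow> nat \<Rightarrow> real" where
  "jordan_prod l y z = (\<lambda>j. if j = 0 then inner_l l y z else y 0 * z j + z 0 * y j)"

(* Left multiplication by the diagonal matrix Gamma = diag (1, -1, ..., -1), both for vectors
   (entries in real) and for matrices given by their rows (entries in real^'n). *)
definition Gam :: "(nat \<Rightarrow> 'a::uminus) \<Rightarrow> nat \<Rightarrow> 'a" where
  "Gam w = (\<lambda>j. if j = 0 then w j else - w j)"

definition tilde :: "nat \<Rightarrow> (nat \<Rightarrow> real) \<Rightarrow> nat \<Rightarrow> real" where
  "tilde l w = (\<lambda>j. if j = 0 then tail_norm l w else w j)"

section \<open>Matrices and derivatives\<close>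

definition outer :: "real^'n \<Rightarrow> real^'n \<Rightarrow> real^'n^'n" where
  "outer u v = (\<chi> a b. u $ a * v $ b)"

(* J d, J^T v and J^T K, for matrices J and K with l rows *)
definition rows_mult_vec :: "(nat \<Rightarrow> real^'n) \<Rightarrow> real^'n \<Rightarrow> nat \<Rightarrow> real" where
  "rows_mult_vec J d = (\<lambda>j. J j \<bullet> d)"

definition transp_mult_vec :: "nat \<Rightarrow> (nat \<Rightarrow> real^'n) \<Rightarrow> (nat \<Rightarrow> real) \<Rightarrow> real^'n" where
  "transp_mult_vec l J v = (\<Sum>j<l. v j *\<^sub>R J j)"

definition transp_mult :: "nat \<Rightarrow> (nat \<Rightarrow> real^'n) \<Rightarrow> (nat \<Rightarrow> real^'n) \<Rightarrow> real^'n^'n" where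
  "transp_mult l J K = (\<Sum>j<l. outer (J j) (K j))"

definition gradient :: "(real^'n \<Rightarrow> real) \<Rightarrow> real^'n \<Rightarrow> real^'n" where
  "gradient \<phi> x = (\<chi> a. frechet_derivative \<phi> (at x) (axis a 1))"

definition hessian :: "(real^'n \<Rightarrow> real) \<Rightarrow> real^'n \<Rightarrow> real^'n^'n" where
  "hessian \<phi> x = jacobian (gradient \<phi>) (at x)"

definition twice_cont_diff :: "(real^'n \<Rightarrow> real) \<Rightarrow> bool" where
  "twice_cont_diff \<phi> \<longleftrightarrow>
     (\<forall>x. \<phi> differentiable (at x)) \<and>
     (\<forall>x. gradient \<phi> differentiable (at x)) \<and>
     continuous_on UNIV (hessian \<phi>)"

definition jac_rows :: "(real^'n \<Rightarrow> nat \<Rightarrow> real) \<Rightarrow> real^'n \<Rightarrow> nat \<Rightarrow> real^'n" where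
  "jac_rows G x = (\<lambda>j. gradient (\<lambda>y. G y j) x)"

section \<open>Second-order cone programs\<close>

(* objf = f; np = p and eqh x i = h_i(x) for i < p; nr = r, sz i = m_i and
   ineq i x j = g_ij(x) for i < r, j < m_i *)
record ('n::finite) socp =
  objf :: "real^'n \<Rightarrow> real"
  np :: nat
  eqh :: "real^'n \<Rightarrow> nat \<Rightarrow> real"
  nr :: nat
  sz :: "nat \<Rightarrow> nat"
  ineq :: "nat \<Rightarrow> real^'n \<Rightarrow> nat \<Rightarrow> real"

definition is_socp :: "('n::finite) socp \<Rightarrow> bool" where
  "is_socp P \<longleftrightarrow>
     (\<forall>i<nr P. sz P i \<ge> 1) \<and>
     twice_cont_diff (objf P) \<and>
     (\<forall>i<np P. twice_cont_diff (\<lambda>x. eqh P x i)) \<and>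
     (\<forall>i<nr P. \<forall>j<sz P i. twice_cont_diff (\<lambda>x. ineq P i x j))"

definition Kcone :: "('n::finite) socp \<Rightarrow> (nat \<Rightarrow> nat \<Rightarrow> real) set" where
  "Kcone P = {w. \<forall>i<nr P. w i \<in> soc (sz P i)}"

definition feasible :: "('n::finite) socp \<Rightarrow> real^'n \<Rightarrow> bool" where
  "feasible P x \<longleftrightarrow> (\<lambda>i. ineq P i x) \<in> Kcone P \<and> (\<forall>i<np P. eqh P x i = 0)"

definition I0 :: "('n::finite) socp \<Rightarrow> real^'n \<Rightarrow> nat set" where
  "I0 P x = {i. i < nr P \<and> (\<forall>j<sz P i. ineq P i x j = 0)}"

definition IB :: "('n::finite) socp \<Rightarrow> real^'n \<Rightarrow> nat set" where
  "IB P x = {i. i < nr P \<and> ineq P i x \<in> soc_bd_plus (sz P i)}"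

definition Dh :: "('n::finite) socp \<Rightarrow> real^'n \<Rightarrow> nat \<Rightarrow> real^'n" where
  "Dh P = jac_rows (eqh P)"

definition Dg :: "('n::finite) socp \<Rightarrow> nat \<Rightarrow> real^'n \<Rightarrow> nat \<Rightarrow> real^'n" where
  "Dg P i = jac_rows (ineq P i)"

definition lagrangian ::
  "('n::finite) socp \<Rightarrow> (nat \<Rightarrow> real) \<Rightarrow> (nat \<Rightarrow> nat \<Rightarrow> real) \<Rightarrow> real^'n \<Rightarrow> real" where
  "lagrangian P \<mu> \<omega> x =
     objf P x + inner_l (np P) (eqh P x) \<mu> - (\<Sum>i<nr P. inner_l (sz P i) (ineq P i x) (\<omega> i))"

definition KKT_triple ::
  "('n::finite) socp \<Rightarrow> real^'n \<Rightarrow> (nat \<Rightarrow> real) \<Rightarrow> (nat \<Rightarrow> nat \<Rightarrow> real) \<Rightarrow> bool" where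
  "KKT_triple P x \<mu> \<omega> \<longleftrightarrow>
     \<omega> \<in> Kcone P \<and> feasible P x \<and>
     gradient (lagrangian P \<mu> \<omega>) x = 0 \<and>
     (\<forall>i<nr P. inner_l (sz P i) (ineq P i x) (\<omega> i) = 0)"

(* xs is the reference point x^* at which the active set is taken *)
definition sigma ::
  "('n::finite) socp \<Rightarrow> real^'n \<Rightarrow> real^'n \<Rightarrow> (nat \<Rightarrow> nat \<Rightarrow> real) \<Rightarrow> real^'n^'n" where
  "sigma P xs x \<omega> =
     (\<Sum>i\<in>IB P xs. - (\<omega> i 0 / ineq P i x 0) *\<^sub>R
        transp_mult (sz P i) (Dg P i x) (Gam (Dg P i x)))"

(* Dg_i(x)^T Gamma_i g~_i(x) *)
definition bd_grad :: "('n::finite) socp \<Rightarrow> nat \<Rightarrow> real^'n \<Rightarrow> real^'n" where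
  "bd_grad P i x =
     transp_mult_vec (sz P i) (Dg P i x) (Gam (tilde (sz P i) (ineq P i x)))"

definition robinson_CQ :: "('n::finite) socp \<Rightarrow> real^'n \<Rightarrow> bool" where
  "robinson_CQ P x \<longleftrightarrow>
     feasible P x \<and>
     dim (Dh P x ` {..<np P}) = np P \<and>
     (\<exists>d. (\<forall>i<nr P. (\<lambda>j. ineq P i x j + rows_mult_vec (Dg P i x) d j) \<in> soc_int (sz P i)) \<and>
          (\<forall>i<np P. rows_mult_vec (Dh P x) d i = 0))"

definition wcr_family :: "('n::finite) socp \<Rightarrow> real^'n \<Rightarrow> real^'n \<Rightarrow> (real^'n) set" where
  "wcr_family P xs x =
     {Dh P x i | i. i < np P} \<union>
     {Dg P i x j | i j. i \<in> I0 P xs \<and> j < sz P i} \<union>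
     {bd_grad P i x | i. i \<in> IB P xs}"

definition WCR :: "('n::finite) socp \<Rightarrow> real^'n \<Rightarrow> bool" where
  "WCR P xs \<longleftrightarrow>
     feasible P xs \<and>
     (\<exists>N. open N \<and> xs \<in> N \<and>
        (\<forall>x\<in>N. dim (wcr_family P xs x) = dim (wcr_family P xs xs)))"

definition crit_subspace :: "('n::finite) socp \<Rightarrow> real^'n \<Rightarrow> (real^'n) set" where
  "crit_subspace P xs =
     {d. (\<forall>i<np P. rows_mult_vec (Dh P xs) d i = 0) \<and>
         (\<forall>i\<in>I0 P xs. \<forall>j<sz P i. rows_mult_vec (Dg P i xs) d j = 0) \<and>
         (\<forall>i\<in>IB P xs. inner_l (sz P i) (ineq P i xs) (Gam (rows_mult_vec (Dg P i xs) d)) = 0)}"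

definition WSONC ::
  "('n::finite) socp \<Rightarrow> real^'n \<Rightarrow> (nat \<Rightarrow> real) \<Rightarrow> (nat \<Rightarrow> nat \<Rightarrow> real) \<Rightarrow> bool" where
  "WSONC P xs \<mu> \<omega> \<longleftrightarrow>
     KKT_triple P xs \<mu> \<omega> \<and>
     (\<forall>d\<in>crit_subspace P xs.
        d \<bullet> ((hessian (lagrangian P \<mu> \<omega>) xs + sigma P xs xs \<omega>) *v d) \<ge> 0)"

definition CAKKT_seq ::
  "('n::finite) socp \<Rightarrow> real^'n \<Rightarrow> (nat \<Rightarrow> real^'n) \<Rightarrow> (nat \<Rightarrow> nat \<Rightarrow> real) \<Rightarrow>
     (nat \<Rightarrow> nat \<Rightarrow> nat \<Rightarrow> real) \<Rightarrow> bool" where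
  "CAKKT_seq P xs x \<mu> \<omega> \<longleftrightarrow>
     feasible P xs \<and>
     x \<longlonglongrightarrow> xs \<and>
     (\<forall>k. \<omega> k \<in> Kcone P) \<and>
     (\<lambda>k. gradient (lagrangian P (\<mu> k) (\<omega> k)) (x k)) \<longlonglongrightarrow> 0 \<and>
     (\<forall>i<nr P. \<forall>j<sz P i.
        (\<lambda>k. jordan_prod (sz P i) (ineq P i (x k)) (\<omega> k i) j) \<longlonglongrightarrow> 0) \<and>
     (\<forall>i<np P. (\<lambda>k. eqh P (x k) i * \<mu> k i) \<longlonglongrightarrow> 0)"

definition CAKKT2 :: "('n::finite) socp \<Rightarrow> real^'n \<Rightarrow> bool" where
  "CAKKT2 P xs \<longleftrightarrow>
     feasible P xs \<and>
     (\<exists>(x :: nat \<Rightarrow> real^'n) (\<mu> :: nat \<Rightarrow> nat \<Rightarrow> real) (\<omega> :: nat \<Rightarrow> nat \<Rightarrow> nat \<Rightarrow> real)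
        (\<eta> :: nat \<Rightarrow> nat \<Rightarrow> real) (\<theta> :: nat \<Rightarrow> nat \<Rightarrow> real) (\<gamma> :: nat \<Rightarrow> nat \<Rightarrow> real)
        (\<delta> :: nat \<Rightarrow> real).
        CAKKT_seq P xs x \<mu> \<omega> \<and>
        (\<forall>k. \<delta> k \<ge> 0) \<and> \<delta> \<longlonglongrightarrow> 0 \<and>
        (\<forall>\<^sub>F k in sequentially. \<forall>d.
           d \<bullet> ((hessian (lagrangian P (\<mu> k) (\<omega> k)) (x k)
               + sigma P xs (x k) (\<omega> k)
               + (\<Sum>i<np P. \<eta> k i *\<^sub>R outer (Dh P (x k) i) (Dh P (x k) i))
               + (\<Sum>i\<in>IB P xs. \<gamma> k i *\<^sub>R outer (bd_grad P i (x k)) (bd_grad P i (x k)))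
               + (\<Sum>i\<in>I0 P xs. \<theta> k i *\<^sub>R
                    transp_mult (sz P i) (Dg P i (x k)) (Dg P i (x k)))
               + \<delta> k *\<^sub>R mat 1) *v d) \<ge> 0))"

end

theory Submission
  imports Defs
begin

text \<open>
  Robinson's constraint qualification makes the approximate multipliers bounded
  (\<open>robinson_multipliers_bounded\<close>). Linear independence of the equality gradients at the limit is
  stable under perturbation, with a uniform constant, so approximate stationarity bounds \<open>\<mu>\<^sup>k\<close> by a
  multiple of the size of \<open>\<omega>\<^sup>k\<close>. Conversely, pairing approximate stationarity with the Robinson
  direction \<open>d\<close> bounds \<open>\<omega>\<^sup>k\<close>: since \<open>g\<^sub>i + Dg\<^sub>i d\<close> lies in the interior of the cone, its inner product
  with \<open>\<omega>\<^sub>i\<^sup>k\<close> is at least a fixed positive multiple of \<open>[\<omega>\<^sub>i\<^sup>k]\<^sub>0\<close>, while the equality multipliers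
  enter only through \<open>Dh(x\<^sup>k) d\<close>, which tends to zero. The two estimates can therefore be solved for
  a bound. Along a subsequence the multipliers converge, and continuity of all data together with
  the vanishing Jordan products turns the limit into a KKT triple.

  For the second-order condition, fix a critical direction at the limit point. The weak constant
  rank property allows it to be approximated by directions \<open>d\<^sup>k\<close> that are exactly orthogonal to
  the active gradients at \<open>x\<^sup>k\<close> (\<open>constant_rank_orthogonal_approximation\<close>). Along such directions
  all the terms weighted by the possibly unbounded \<open>\<eta>\<^sup>k\<close>, \<open>\<theta>\<^sup>k\<close> and \<open>\<gamma>\<^sup>k\<close> vanish
  (\<open>penalty_terms_vanish\<close>), so the approximate second-order inequality only involves quantities
  that converge, and its limit is the claim.
\<close>

section \<open>Gradients and Hessians\<close>

text \<open>
  The gradient lists the partial derivatives; by linearity these determine the Frechet derivative.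
\<close>

lemma has_derivative_gradient:
  assumes "\<phi> differentiable (at x)"
  shows "(\<phi> has_derivative (\<lambda>d. gradient \<phi> x \<bullet> d)) (at x)"
proof -
  let ?D = "frechet_derivative \<phi> (at x)"
  have D: "(\<phi> has_derivative ?D) (at x)"
    using assms frechet_derivative_works by blast
  then have lin: "linear ?D"
    by (rule has_derivative_linear)
  have "?D d = gradient \<phi> x \<bullet> d" for d
  proof -
    have "?D d = ?D (\<Sum>a\<in>UNIV. d $ a *\<^sub>R axis a 1)"
      by (subst basis_expansion[symmetric, of d]) (simp add: scalar_mult_eq_scaleR)
    also have "\<dots> = (\<Sum>a\<in>UNIV. d $ a * ?D (axis a 1))"
      using lin by (simp add: linear_sum linear_cmul)
    also have "\<dots> = gradient \<phi> x \<bullet> d"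
      by (simp add: gradient_def inner_vec_def mult.commute)
    finally show ?thesis .
  qed
  then have "?D = (\<lambda>d. gradient \<phi> x \<bullet> d)" by auto
  with D show ?thesis by simp
qed

lemma gradient_eqI:
  assumes "(\<phi> has_derivative (\<lambda>d. g \<bullet> d)) (at x)"
  shows "gradient \<phi> x = g"
proof -
  have "frechet_derivative \<phi> (at x) = (\<lambda>d. g \<bullet> d)"
    using frechet_derivative_at[OF assms] by simp
  then show ?thesis
    by (simp add: gradient_def vec_eq_iff inner_axis)
qed

lemma hessian_eqI:
  assumes "(gradient \<phi> has_derivative (\<lambda>d. H *v d)) (at x)"
  shows "hessian \<phi> x = H"
proof -
  have "frechet_derivative (gradient \<phi>) (at x) = (\<lambda>d. H *v d)"
    using frechet_derivative_at[OF assms] by simp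
  then show ?thesis
    by (simp add: hessian_def jacobian_def)
qed

lemma has_derivative_hessian:
  assumes "twice_cont_diff \<phi>"
  shows "(gradient \<phi> has_derivative (\<lambda>d. hessian \<phi> x *v d)) (at x)"
  using assms unfolding twice_cont_diff_def hessian_def by (metis jacobian_works)

lemma twice_cont_diff_tendsto:
  assumes "twice_cont_diff \<phi>" and "(X \<longlongrightarrow> x) F"
  shows "((\<lambda>k. \<phi> (X k)) \<longlongrightarrow> \<phi> x) F"
    and "((\<lambda>k. gradient \<phi> (X k)) \<longlongrightarrow> gradient \<phi> x) F"
    and "((\<lambda>k. hessian \<phi> (X k)) \<longlongrightarrow> hessian \<phi> x) F"
proof -
  have "isCont \<phi> x" "isCont (gradient \<phi>) x" "isCont (hessian \<phi>) x"
    using assms(1) unfolding twice_cont_diff_def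
    by (auto simp: differentiable_imp_continuous_within continuous_on_eq_continuous_at)
  then show "((\<lambda>k. \<phi> (X k)) \<longlongrightarrow> \<phi> x) F"
    and "((\<lambda>k. gradient \<phi> (X k)) \<longlongrightarrow> gradient \<phi> x) F"
    and "((\<lambda>k. hessian \<phi> (X k)) \<longlongrightarrow> hessian \<phi> x) F"
    using assms(2) by (auto intro: isCont_tendsto_compose)
qed

lemma lagrangian_gradient:
  assumes "is_socp P"
  shows "gradient (lagrangian P \<mu> \<omega>) x =
    gradient (objf P) x + transp_mult_vec (np P) (Dh P x) \<mu>
      - (\<Sum>i<nr P. transp_mult_vec (sz P i) (Dg P i x) (\<omega> i))"
proof (rule gradient_eqI)
  have f: "(objf P has_derivative (\<lambda>d. gradient (objf P) x \<bullet> d)) (at x)"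
    and h: "\<And>i. i < np P \<Longrightarrow> ((\<lambda>y. eqh P y i) has_derivative (\<lambda>d. Dh P x i \<bullet> d)) (at x)"
    and g: "\<And>i j. i < nr P \<Longrightarrow> j < sz P i \<Longrightarrow>
       ((\<lambda>y. ineq P i y j) has_derivative (\<lambda>d. Dg P i x j \<bullet> d)) (at x)"
    using assms unfolding is_socp_def twice_cont_diff_def Dh_def Dg_def jac_rows_def
    by (auto intro!: has_derivative_gradient)
  have "(lagrangian P \<mu> \<omega> has_derivative (\<lambda>d. gradient (objf P) x \<bullet> d
      + (\<Sum>i<np P. (Dh P x i \<bullet> d) * \<mu> i) - (\<Sum>i<nr P. \<Sum>j<sz P i. (Dg P i x j \<bullet> d) * \<omega> i j))) (at x)"
    unfolding lagrangian_def inner_l_def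
    by (intro has_derivative_add has_derivative_diff has_derivative_sum has_derivative_mult_left f h g)
      auto
  then show "(lagrangian P \<mu> \<omega> has_derivative (\<lambda>d. (gradient (objf P) x
      + transp_mult_vec (np P) (Dh P x) \<mu>
      - (\<Sum>i<nr P. transp_mult_vec (sz P i) (Dg P i x) (\<omega> i))) \<bullet> d)) (at x)"
    by (simp add: transp_mult_vec_def inner_add_left inner_diff_left inner_sum_left mult.commute)
qed

lemma sum_matrix_vector_mult:
  fixes A :: "'i \<Rightarrow> real^'n^'m"
  shows "(\<Sum>i\<in>I. A i) *v d = (\<Sum>i\<in>I. A i *v d)"
  by (induction I rule: infinite_finite_induct)
    (auto simp: matrix_vector_mult_add_rdistrib)

lemma lagrangian_hessian:
  assumes "is_socp P"
  shows "hessian (lagrangian P \<mu> \<omega>) x =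
    hessian (objf P) x + (\<Sum>i<np P. \<mu> i *\<^sub>R hessian (\<lambda>y. eqh P y i) x)
      - (\<Sum>i<nr P. \<Sum>j<sz P i. \<omega> i j *\<^sub>R hessian (\<lambda>y. ineq P i y j) x)"
proof (rule hessian_eqI)
  have f: "(gradient (objf P) has_derivative (\<lambda>d. hessian (objf P) x *v d)) (at x)"
    and h: "\<And>i. i < np P \<Longrightarrow> (gradient (\<lambda>y. eqh P y i) has_derivative
       (\<lambda>d. hessian (\<lambda>y. eqh P y i) x *v d)) (at x)"
    and g: "\<And>i j. i < nr P \<Longrightarrow> j < sz P i \<Longrightarrow> (gradient (\<lambda>y. ineq P i y j) has_derivative
       (\<lambda>d. hessian (\<lambda>y. ineq P i y j) x *v d)) (at x)"
    using assms unfolding is_socp_def by (auto intro: has_derivative_hessian)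
  have G: "gradient (lagrangian P \<mu> \<omega>) = (\<lambda>x.
    gradient (objf P) x + (\<Sum>i<np P. \<mu> i *\<^sub>R gradient (\<lambda>y. eqh P y i) x)
      - (\<Sum>i<nr P. \<Sum>j<sz P i. \<omega> i j *\<^sub>R gradient (\<lambda>y. ineq P i y j) x))"
    by (rule ext) (simp add: lagrangian_gradient[OF assms] transp_mult_vec_def Dh_def Dg_def
        jac_rows_def)
  have "(gradient (lagrangian P \<mu> \<omega>) has_derivative (\<lambda>d. hessian (objf P) x *v d
      + (\<Sum>i<np P. \<mu> i *\<^sub>R (hessian (\<lambda>y. eqh P y i) x *v d))
      - (\<Sum>i<nr P. \<Sum>j<sz P i. \<omega> i j *\<^sub>R (hessian (\<lambda>y. ineq P i y j) x *v d)))) (at x)"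
    unfolding G
    by (intro has_derivative_add has_derivative_diff has_derivative_sum has_derivative_scaleR_right
        f h g) auto
  then show "(gradient (lagrangian P \<mu> \<omega>) has_derivative (\<lambda>d. (hessian (objf P) x
      + (\<Sum>i<np P. \<mu> i *\<^sub>R hessian (\<lambda>y. eqh P y i) x)
      - (\<Sum>i<nr P. \<Sum>j<sz P i. \<omega> i j *\<^sub>R hessian (\<lambda>y. ineq P i y j) x)) *v d)) (at x)"
    by (simp add: matrix_vector_mult_add_rdistrib matrix_vector_mult_diff_rdistrib
        sum_matrix_vector_mult scaleR_matrix_vector_assoc)
qed

section \<open>Perturbed linear families\<close>

text \<open>
  Each coefficient is the value of a dual functional, and linear functionals on a Euclidean space
  are bounded.
\<close>

lemma independent_coefficients_bounded:
  fixes W :: "'i \<Rightarrow> 'v::euclidean_space"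
  assumes "finite A" and "inj_on W A" and "independent (W ` A)"
  shows "\<exists>K>0. \<forall>c. (\<Sum>a\<in>A. \<bar>c a\<bar>) \<le> K * norm (\<Sum>a\<in>A. c a *\<^sub>R W a)"
proof -
  have "\<exists>\<phi> :: 'v \<Rightarrow> real. linear \<phi> \<and> (\<forall>x\<in>W ` A. \<phi> x = (if x = W a then 1 else 0))" for a
    using linear_independent_extend[OF assms(3), of "\<lambda>x. if x = W a then 1 else 0"] by simp
  then obtain \<phi> :: "'i \<Rightarrow> 'v \<Rightarrow> real" where lin: "\<And>a. linear (\<phi> a)"
    and val: "\<And>a x. x \<in> W ` A \<Longrightarrow> \<phi> a x = (if x = W a then 1 else 0)"
    by metis
  have "\<exists>B>0. \<forall>x. norm (\<phi> a x) \<le> B * norm x" for a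
    using linear_bounded_pos[OF lin] by metis
  then obtain B where B: "\<And>a. B a > 0" "\<And>a x. norm (\<phi> a x) \<le> B a * norm x"
    by metis
  have "(\<Sum>a\<in>A. \<bar>c a\<bar>) \<le> (1 + sum B A) * norm (\<Sum>a\<in>A. c a *\<^sub>R W a)" for c
  proof -
    let ?w = "\<Sum>b\<in>A. c b *\<^sub>R W b"
    have "c a = \<phi> a ?w" if "a \<in> A" for a
    proof -
      have "\<phi> a ?w = (\<Sum>b\<in>A. c b * \<phi> a (W b))"
        using lin by (simp add: linear_sum linear_cmul)
      also have "\<dots> = (\<Sum>b\<in>A. if b = a then c b else 0)"
        using that assms(2) by (intro sum.cong) (auto simp: val inj_on_eq_iff)
      also have "\<dots> = c a"
        using that assms(1) by simp
      finally show ?thesis by simp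
    qed
    then have "(\<Sum>a\<in>A. \<bar>c a\<bar>) \<le> (\<Sum>a\<in>A. B a * norm ?w)"
      using B(2) by (intro sum_mono) (metis real_norm_def)
    then show ?thesis
      by (simp add: sum_distrib_right distrib_right add_increasing)
  qed
  moreover have "1 + sum B A > 0"
    using B(1) by (meson add_pos_nonneg less_imp_le sum_nonneg zero_less_one)
  ultimately show ?thesis by blast
qed

text \<open>
  Moving the vectors by at most \<open>1 / (2 * K)\<close> changes a linear combination by at most half of what
  the unperturbed bound controls, so the constant at most doubles. Uniformity in the coefficients
  is what later allows them to be taken dependent on the perturbation.
\<close>

lemma perturbed_coefficients_bounded:
  fixes W :: "'i \<Rightarrow> 'v::euclidean_space"
  assumes "finite A" and "inj_on W A" and "independent (W ` A)"
    and lim: "\<And>a. a \<in> A \<Longrightarrow> ((\<lambda>k. V k a) \<longlongrightarrow> W a) F"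
  shows "\<exists>K>0. \<forall>\<^sub>F k in F. \<forall>c. (\<Sum>a\<in>A. \<bar>c a\<bar>) \<le> K * norm (\<Sum>a\<in>A. c a *\<^sub>R V k a)"
proof -
  obtain K where K: "K > 0"
    "\<And>c. (\<Sum>a\<in>A. \<bar>c a\<bar>) \<le> K * norm (\<Sum>a\<in>A. c a *\<^sub>R W a)"
    using independent_coefficients_bounded[OF assms(1-3)] by blast
  have "\<forall>\<^sub>F k in F. \<forall>a\<in>A. dist (V k a) (W a) < 1 / (2 * K)"
    using assms(1) lim K(1) by (intro eventually_ball_finite ballI tendstoD) auto
  then have "\<forall>\<^sub>F k in F. \<forall>c. (\<Sum>a\<in>A. \<bar>c a\<bar>) \<le> (2 * K) * norm (\<Sum>a\<in>A. c a *\<^sub>R V k a)"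
  proof (rule eventually_mono, intro allI)
    fix k and c :: "'i \<Rightarrow> real"
    assume near: "\<forall>a\<in>A. dist (V k a) (W a) < 1 / (2 * K)"
    let ?s = "\<Sum>a\<in>A. \<bar>c a\<bar>"
    let ?v = "\<Sum>a\<in>A. c a *\<^sub>R V k a" and ?w = "\<Sum>a\<in>A. c a *\<^sub>R W a"
    have "norm (?w - ?v) = norm (\<Sum>a\<in>A. c a *\<^sub>R (W a - V k a))"
      by (simp add: scaleR_diff_right sum_subtractf)
    also have "\<dots> \<le> (\<Sum>a\<in>A. \<bar>c a\<bar> * (1 / (2 * K)))"
    proof (rule sum_norm_le)
      fix a assume "a \<in> A"
      then have "norm (W a - V k a) \<le> 1 / (2 * K)"
        using near by (simp add: dist_norm norm_minus_commute less_imp_le)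
      then show "norm (c a *\<^sub>R (W a - V k a)) \<le> \<bar>c a\<bar> * (1 / (2 * K))"
        unfolding norm_scaleR by (rule mult_left_mono) simp
    qed
    also have "\<dots> = ?s / (2 * K)"
      by (simp add: sum_divide_distrib)
    finally have "norm ?w \<le> norm ?v + ?s / (2 * K)"
      using norm_triangle_sub[of ?w ?v] by linarith
    then have "K * norm ?w \<le> K * (norm ?v + ?s / (2 * K))"
      using K(1) by simp
    with K(2)[of c] have "?s \<le> K * (norm ?v + ?s / (2 * K))"
      by linarith
    also have "\<dots> = K * norm ?v + ?s / 2"
      using K(1) by (simp add: distrib_left)
    finally show "?s \<le> (2 * K) * norm ?v" by simp
  qed
  then show ?thesis using K(1) by (intro exI[of _ "2 * K"]) auto
qed

text \<open>
  Together with the preceding lemma this says that linear independence is an open condition.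
\<close>

lemma coefficients_bounded_imp_independent:
  fixes V :: "'i \<Rightarrow> 'v::real_normed_vector"
  assumes "finite A" and "\<And>c. (\<Sum>a\<in>A. \<bar>c a\<bar>) \<le> K * norm (\<Sum>a\<in>A. c a *\<^sub>R V a)"
  shows "inj_on V A \<and> independent (V ` A)"
proof -
  have zero: "c a = 0" if "(\<Sum>b\<in>A. c b *\<^sub>R V b) = 0" and "a \<in> A" for c a
  proof -
    have "(\<Sum>b\<in>A. \<bar>c b\<bar>) \<le> 0"
      using assms(2)[of c] that(1) by simp
    then have "(\<Sum>b\<in>A. \<bar>c b\<bar>) = 0"
      by (simp add: order_antisym sum_nonneg)
    then show ?thesis
      using assms(1) that(2) by (simp add: sum_nonneg_eq_0_iff)
  qed
  have inj: "inj_on V A"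
  proof (rule inj_onI, rule ccontr)
    fix a b assume ab: "a \<in> A" "b \<in> A" "V a = V b" "a \<noteq> b"
    let ?c = "\<lambda>i. (if i = a then 1 else 0) - (if i = b then 1 else (0::real))"
    have "(\<Sum>i\<in>A. ?c i *\<^sub>R V i) =
        (\<Sum>i\<in>A. if i = a then V i else 0) - (\<Sum>i\<in>A. if i = b then V i else 0)"
      unfolding sum_subtractf[symmetric] by (intro sum.cong) (auto simp: scaleR_diff_left)
    then have "(\<Sum>i\<in>A. ?c i *\<^sub>R V i) = 0"
      using ab assms(1) by simp
    from zero[OF this ab(1)] ab(4) show False by simp
  qed
  moreover have "independent (V ` A)"
    unfolding independent_explicit_finite_subsets
  proof (intro allI impI ballI)
    fix S u v
    assume S: "S \<subseteq> V ` A" "finite S" and 0: "(\<Sum>v\<in>S. u v *\<^sub>R v) = 0" and v: "v \<in> S"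
    let ?u = "\<lambda>v. if v \<in> S then u v else 0"
    have "(\<Sum>a\<in>A. ?u (V a) *\<^sub>R V a) = (\<Sum>v\<in>V ` A. ?u v *\<^sub>R v)"
      by (simp add: sum.reindex[OF inj] o_def)
    also have "\<dots> = (\<Sum>v\<in>S. u v *\<^sub>R v)"
      using S assms(1) by (intro sum.mono_neutral_cong_right) auto
    finally have "(\<Sum>a\<in>A. ?u (V a) *\<^sub>R V a) = 0"
      using 0 by simp
    then have "?u (V a) = 0" if "a \<in> A" for a
      using zero[of "\<lambda>a. ?u (V a)"] that by blast
    with S(1) v show "u v = 0"
      by (metis (no_types, lifting) image_iff subsetD)
  qed
  ultimately show ?thesis by blast
qed

lemma span_image_coefficients:
  fixes f :: "'i \<Rightarrow> 'v::real_vector"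
  assumes "finite B" "inj_on f B" "x \<in> span (f ` B)"
  shows "\<exists>u. x = (\<Sum>b\<in>B. u b *\<^sub>R f b)"
proof -
  have "x \<in> range (\<lambda>u. \<Sum>v\<in>f ` B. u v *\<^sub>R v)"
    using assms by (simp only: span_finite finite_imageI)
  then obtain u where "x = (\<Sum>v\<in>f ` B. u v *\<^sub>R v)" by (rule imageE)
  then have "x = (\<Sum>b\<in>B. u (f b) *\<^sub>R f b)"
    by (simp only: sum.reindex[OF assms(2)] o_def)
  then show ?thesis by (rule exI[of _ "\<lambda>b. u (f b)"])
qed

text \<open>
  Lower semicontinuity of the orthogonal complement. The approximating vectors are the components
  of \<open>d\<close> orthogonal to the perturbed family, so the projections \<open>e\<close> onto its span have to tend
  to zero. A maximal independent subfamily of the limit remains independent, and since the rank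
  does not jump it still spans. Hence \<open>e\<close> is a combination of that subfamily with coefficients at
  most \<open>K * norm e\<close>, and \<open>e \<bullet> e = e \<bullet> d\<close> then bounds \<open>norm e\<close> by the inner products of \<open>d\<close> with
  the perturbed subfamily, which vanish in the limit.
\<close>

lemma constant_rank_orthogonal_approximation:
  fixes V :: "nat \<Rightarrow> 'i \<Rightarrow> 'v::euclidean_space"
  assumes fin: "finite A"
    and lim: "\<And>a. a \<in> A \<Longrightarrow> (\<lambda>k. V k a) \<longlonglongrightarrow> W a"
    and rank: "\<forall>\<^sub>F k in sequentially. dim (V k ` A) = dim (W ` A)"
    and orth: "\<And>a. a \<in> A \<Longrightarrow> W a \<bullet> d = 0"
  shows "\<exists>D. D \<longlonglongrightarrow> d \<and> (\<forall>k. \<forall>a\<in>A. V k a \<bullet> D k = 0)"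
proof -
  have "\<exists>e z. e \<in> span (V k ` A) \<and> (\<forall>w\<in>span (V k ` A). orthogonal z w) \<and> d = e + z" for k
    by (rule orthogonal_subspace_decomp_exists[of "V k ` A" d]) blast
  then obtain e z where e: "\<And>k. e k \<in> span (V k ` A)"
    and z: "\<And>k w. w \<in> span (V k ` A) \<Longrightarrow> orthogonal (z k) w" and d: "\<And>k. d = e k + z k"
    by metis
  obtain C where C: "C \<subseteq> W ` A" "independent C" "W ` A \<subseteq> span C" "card C = dim (W ` A)"
    using basis_exists[of "W ` A"] by blast
  obtain B where B: "B \<subseteq> A" "inj_on W B" "C = W ` B"
    using C(1) by (meson subset_image_inj)
  have finB: "finite B" using B(1) fin finite_subset by blast
  obtain K where K: "K > 0"
    "\<forall>\<^sub>F k in sequentially. \<forall>c. (\<Sum>a\<in>B. \<bar>c a\<bar>) \<le> K * norm (\<Sum>a\<in>B. c a *\<^sub>R V k a)"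
    using perturbed_coefficients_bounded[OF finB B(2), of V sequentially] lim B C(2) by blast
  have "\<forall>\<^sub>F k in sequentially. norm (e k) \<le> K * (\<Sum>b\<in>B. \<bar>V k b \<bullet> d\<bar>)"
    using K(2) rank
  proof eventually_elim
    case (elim k)
    have ind: "inj_on (V k) B" "independent (V k ` B)"
      using coefficients_bounded_imp_independent[OF finB, of K "V k"] elim(1) by auto
    have "card (V k ` B) = dim (V k ` A)"
      using elim(2) C(4) B ind(1) by (simp add: card_image)
    then have "V k ` A \<subseteq> span (V k ` B)"
      using B(1) ind(2) by (intro card_ge_dim_independent) auto
    then have "e k \<in> span (V k ` B)"
      using e[of k] span_minimal[OF _ subspace_span] by blast
    then obtain u where ec: "e k = (\<Sum>b\<in>B. u b *\<^sub>R V k b)"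
      using span_image_coefficients[OF finB ind(1)] by blast
    have cb: "(\<Sum>b\<in>B. \<bar>u b\<bar>) \<le> K * norm (e k)"
      unfolding ec using elim(1) by blast
    have "e k \<bullet> d = e k \<bullet> e k + e k \<bullet> z k"
      by (subst d[of k]) (simp add: inner_add_right)
    also have "\<dots> = norm (e k) * norm (e k)"
      using z[OF e, of k] by (simp add: orthogonal_def inner_commute norm_eq_sqrt_inner)
    finally have "norm (e k) * norm (e k) = e k \<bullet> d" by simp
    also have "\<dots> = (\<Sum>b\<in>B. u b * (V k b \<bullet> d))"
      by (simp add: ec inner_sum_left)
    also have "\<dots> \<le> (\<Sum>b\<in>B. \<bar>u b\<bar> * \<bar>V k b \<bullet> d\<bar>)"
      by (intro sum_mono) (metis abs_ge_self abs_mult)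
    also have "\<dots> \<le> (\<Sum>b\<in>B. \<bar>u b\<bar> * (\<Sum>b\<in>B. \<bar>V k b \<bullet> d\<bar>))"
      using finB by (intro sum_mono mult_left_mono member_le_sum) auto
    also have "\<dots> = (\<Sum>b\<in>B. \<bar>u b\<bar>) * (\<Sum>b\<in>B. \<bar>V k b \<bullet> d\<bar>)"
      by (simp add: sum_distrib_right)
    also have "\<dots> \<le> (K * norm (e k)) * (\<Sum>b\<in>B. \<bar>V k b \<bullet> d\<bar>)"
      using cb by (intro mult_right_mono sum_nonneg) auto
    finally have "norm (e k) * norm (e k) \<le> norm (e k) * (K * (\<Sum>b\<in>B. \<bar>V k b \<bullet> d\<bar>))"
      by (simp add: algebra_simps)
    moreover have "0 \<le> K * (\<Sum>b\<in>B. \<bar>V k b \<bullet> d\<bar>)"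
      using K(1) by (simp add: sum_nonneg)
    ultimately show ?case
      by (cases "norm (e k) = 0") (auto simp: mult_le_cancel_left)
  qed
  moreover have "(\<lambda>k. K * (\<Sum>b\<in>B. \<bar>V k b \<bullet> d\<bar>)) \<longlonglongrightarrow> 0"
  proof -
    have "(\<lambda>k. K * (\<Sum>b\<in>B. \<bar>V k b \<bullet> d\<bar>)) \<longlonglongrightarrow> K * (\<Sum>b\<in>B. \<bar>W b \<bullet> d\<bar>)"
      using B(1) by (intro tendsto_intros lim) auto
    moreover have "(\<Sum>b\<in>B. \<bar>W b \<bullet> d\<bar>) = 0"
      using B(1) orth by (intro sum.neutral) auto
    ultimately show ?thesis by simp
  qed
  ultimately have "e \<longlonglongrightarrow> 0"
    by (rule Lim_null_comparison)
  then have "(\<lambda>k. d - e k) \<longlonglongrightarrow> d"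
    using tendsto_diff[OF tendsto_const[of d sequentially], of e 0] by simp
  moreover have "d - e k = z k" for k
    using d[of k] by (simp add: algebra_simps)
  ultimately have "z \<longlonglongrightarrow> d" by simp
  moreover have "V k a \<bullet> z k = 0" if "a \<in> A" for k a
    using z[of "V k a" k] that by (simp add: orthogonal_def inner_commute span_base)
  ultimately show ?thesis by blast
qed

lemma convergent_subsequence_finite_family:
  fixes f :: "nat \<Rightarrow> 'i \<Rightarrow> real"
  assumes "finite I" and "\<And>i. i \<in> I \<Longrightarrow> Bseq (\<lambda>k. f k i)"
  shows "\<exists>r l. strict_mono (r :: nat \<Rightarrow> nat) \<and> (\<forall>i\<in>I. (\<lambda>k. f (r k) i) \<longlonglongrightarrow> l i)"
  using assms
proof (induction I rule: finite_induct)
  case empty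
  then show ?case using strict_mono_id by auto
next
  case (insert a I)
  then obtain r l where r: "strict_mono (r :: nat \<Rightarrow> nat)" "\<forall>i\<in>I. (\<lambda>k. f (r k) i) \<longlonglongrightarrow> l i"
    by blast
  have "Bseq (\<lambda>k. f (r k) a)"
    using Bseq_subseq[OF insert.prems[of a], of r] by simp
  then have "bounded (range (\<lambda>k. f (r k) a))"
    by (simp only: Bseq_eq_bounded)
  from bounded_imp_convergent_subsequence[OF this] obtain m s
    where s: "strict_mono (s :: nat \<Rightarrow> nat)" "((\<lambda>k. f (r k) a) \<circ> s) \<longlonglongrightarrow> m"
    by blast
  have "(\<lambda>k. f (r (s k)) i) \<longlonglongrightarrow> (l(a := m)) i" if "i \<in> insert a I" for i
  proof (cases "i = a")
    case True
    then show ?thesis using s(2) by (simp add: o_def)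
  next
    case False
    then have "i \<in> I" using that by simp
    then have "((\<lambda>k. f (r k) i) \<circ> s) \<longlonglongrightarrow> l i"
      using r(2) s(1) LIMSEQ_subseq_LIMSEQ by blast
    then show ?thesis using False by (simp add: o_def)
  qed
  moreover have "strict_mono (r \<circ> s)" using r(1) s(1) by (rule strict_mono_o)
  ultimately show ?case
    by (intro exI[of _ "r \<circ> s"] exI[of _ "l(a := m)"]) (simp add: o_def)
qed

section \<open>The second-order cone\<close>

lemma tail_norm_L2: "tail_norm l w = L2_set w {1..<l}"
  by (simp add: tail_norm_def L2_set_def)

lemma soc_entry_le:
  assumes "w \<in> soc l" and "j < l"
  shows "\<bar>w j\<bar> \<le> w 0"
proof -
  have t: "tail_norm l w \<le> w 0" "0 \<le> tail_norm l w"
    using assms(1) by (auto simp: soc_def tail_norm_L2)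
  show ?thesis
  proof (cases "j = 0")
    case False
    then have "\<bar>w j\<bar> \<le> L2_set (\<lambda>j. \<bar>w j\<bar>) {1..<l}"
      using assms(2) by (intro member_le_L2_set[of _ _ "\<lambda>j. \<bar>w j\<bar>"]) auto
    then show ?thesis using t by (simp add: tail_norm_L2 L2_set_def)
  qed (use t in auto)
qed

text \<open>
  Cauchy-Schwarz on the tails. For \<open>w\<close> in the interior of the cone this is a quantitative form of
  self-duality: the inner product controls the whole size of \<open>z\<close>.
\<close>

lemma inner_soc_lower_bound:
  assumes "z \<in> soc l" and "l \<ge> 1"
  shows "(w 0 - tail_norm l w) * z 0 \<le> inner_l l w z"
proof -
  have split: "{..<l} = insert 0 {1..<l}" using assms(2) by auto
  have "inner_l l w z = w 0 * z 0 + (\<Sum>j\<in>{1..<l}. w j * z j)"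
    unfolding inner_l_def split by simp
  moreover have "- (\<Sum>j\<in>{1..<l}. w j * z j) \<le> (\<Sum>j\<in>{1..<l}. \<bar>w j\<bar> * \<bar>z j\<bar>)"
    unfolding sum_negf[symmetric] by (intro sum_mono) (metis abs_ge_minus_self abs_mult)
  moreover have "\<dots> \<le> tail_norm l w * tail_norm l z"
    unfolding tail_norm_L2 by (rule L2_set_mult_ineq)
  moreover have "tail_norm l w * tail_norm l z \<le> tail_norm l w * z 0"
    using assms(1) by (intro mult_left_mono) (auto simp: soc_def tail_norm_L2)
  ultimately show ?thesis by (simp add: algebra_simps)
qed

lemma tail_norm_tendsto:
  assumes "\<And>j. j < l \<Longrightarrow> ((\<lambda>k. w k j) \<longlongrightarrow> v j) F"
  shows "((\<lambda>k. tail_norm l (w k)) \<longlongrightarrow> tail_norm l v) F"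
  unfolding tail_norm_def using assms by (intro tendsto_intros) auto

lemma Kcone_limit:
  assumes "\<And>k. \<omega> k \<in> Kcone P" and "\<And>i. i < nr P \<Longrightarrow> sz P i \<ge> 1"
    and lim: "\<And>i j. i < nr P \<Longrightarrow> j < sz P i \<Longrightarrow> (\<lambda>k. \<omega> k i j) \<longlonglongrightarrow> w i j"
  shows "w \<in> Kcone P"
proof -
  have "tail_norm (sz P i) (w i) \<le> w i 0" if i: "i < nr P" for i
  proof (rule tendsto_le[OF sequentially_bot])
    show "(\<lambda>k. \<omega> k i 0) \<longlonglongrightarrow> w i 0"
      using lim[OF i, of 0] assms(2)[OF i] by simp
    show "(\<lambda>k. tail_norm (sz P i) (\<omega> k i)) \<longlonglongrightarrow> tail_norm (sz P i) (w i)"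
      using lim[OF i] by (rule tail_norm_tendsto)
    show "\<forall>\<^sub>F k in sequentially. tail_norm (sz P i) (\<omega> k i) \<le> \<omega> k i 0"
      using assms(1) i by (auto simp: Kcone_def soc_def)
  qed
  then show ?thesis by (auto simp: Kcone_def soc_def)
qed

section \<open>Matrix-vector identities\<close>

lemma outer_mult_vec: "outer u v *v d = (v \<bullet> d) *\<^sub>R u"
  by (simp add: vec_eq_iff outer_def matrix_vector_mult_def inner_vec_def sum_distrib_left
      mult_ac)

lemma transp_mult_mult_vec: "transp_mult l J K *v d = (\<Sum>j<l. (K j \<bullet> d) *\<^sub>R J j)"
  by (simp add: transp_mult_def sum_matrix_vector_mult outer_mult_vec)

lemma outer_tendsto:
  assumes "(u \<longlongrightarrow> a) F" and "(v \<longlongrightarrow> b) F"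
  shows "((\<lambda>k. outer (u k) (v k)) \<longlongrightarrow> outer a b) F"
  unfolding outer_def by (intro vec_tendstoI) (auto intro!: tendsto_intros tendsto_vec_nth assms)

lemma quadratic_form_tendsto:
  fixes M :: "'k \<Rightarrow> real^'n^'n"
  assumes "(M \<longlongrightarrow> H) F" and "(D \<longlongrightarrow> d) F"
  shows "((\<lambda>k. D k \<bullet> (M k *v D k)) \<longlongrightarrow> d \<bullet> (H *v d)) F"
  unfolding matrix_vector_mult_def inner_vec_def
  using assms by (auto intro!: tendsto_intros tendsto_vec_nth)

text \<open>
  On the boundary of the cone \<open>g\<close> and \<open>tilde g\<close> coincide, so the vectors in the constant rank
  family and the linear forms defining the critical subspace agree at the reference point.
\<close>

lemma bd_grad_at_boundary:
  assumes "i \<in> IB P x"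
  shows "bd_grad P i x \<bullet> d = inner_l (sz P i) (ineq P i x) (Gam (rows_mult_vec (Dg P i x) d))"
proof -
  have "tilde (sz P i) (ineq P i x) = ineq P i x"
    using assms by (auto simp: IB_def soc_bd_plus_def tilde_def fun_eq_iff)
  then show ?thesis
    unfolding bd_grad_def transp_mult_vec_def inner_l_def inner_sum_left
    by (intro sum.cong) (auto simp: Gam_def rows_mult_vec_def)
qed

section \<open>Boundedness of the multipliers\<close>

lemma socp_data_tendsto:
  assumes "is_socp P" and "(x \<longlongrightarrow> xs) F"
  shows "((\<lambda>k. gradient (objf P) (x k)) \<longlongrightarrow> gradient (objf P) xs) F"
    and "i < np P \<Longrightarrow> ((\<lambda>k. Dh P (x k) i) \<longlongrightarrow> Dh P xs i) F"
    and "i < nr P \<Longrightarrow> j < sz P i \<Longrightarrow> ((\<lambda>k. ineq P i (x k) j) \<longlongrightarrow> ineq P i xs j) F"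
    and "i < nr P \<Longrightarrow> j < sz P i \<Longrightarrow> ((\<lambda>k. Dg P i (x k) j) \<longlongrightarrow> Dg P i xs j) F"
  using assms unfolding is_socp_def Dh_def Dg_def jac_rows_def
  by (auto intro: twice_cont_diff_tendsto(2) twice_cont_diff_tendsto(1)[of "\<lambda>y. ineq P i y j"])

text \<open>
  With \<open>M\<close> and \<open>\<Omega>\<close> the sizes of the equality and cone multipliers, the proof combines two estimates,
  \<open>M \<le> K * (c + \<Omega> * C)\<close> from linear independence and \<open>\<epsilon> * \<Omega> \<le> R + M * T\<close> from the Robinson direction,
  where \<open>T\<close> tends to zero.
\<close>

lemma robinson_multipliers_bounded:
  assumes socp: "is_socp P" and rob: "robinson_CQ P xs" and seq: "CAKKT_seq P xs x \<mu> \<omega>"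
  shows "\<exists>B. \<forall>\<^sub>F k in sequentially. (\<Sum>i<np P. \<bar>\<mu> k i\<bar>) \<le> B \<and> (\<Sum>i<nr P. \<omega> k i 0) \<le> B"
proof -
  have sz: "sz P i \<ge> 1" if "i < nr P" for i
    using socp that by (simp add: is_socp_def)
  have X: "x \<longlonglongrightarrow> xs" and cone: "\<And>k i. i < nr P \<Longrightarrow> \<omega> k i \<in> soc (sz P i)"
    and G0: "(\<lambda>k. gradient (lagrangian P (\<mu> k) (\<omega> k)) (x k)) \<longlonglongrightarrow> 0"
    using seq by (auto simp: CAKKT_seq_def Kcone_def)
  have compl: "(\<lambda>k. inner_l (sz P i) (ineq P i (x k)) (\<omega> k i)) \<longlonglongrightarrow> 0" if "i < nr P" for i
  proof -
    have "(\<lambda>k. jordan_prod (sz P i) (ineq P i (x k)) (\<omega> k i) 0) \<longlonglongrightarrow> 0"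
      using seq sz[OF that] that unfolding CAKKT_seq_def by (meson less_le_trans zero_less_one)
    then show ?thesis by (simp add: jordan_prod_def)
  qed
  note data = socp_data_tendsto[OF socp X]
  obtain d where int: "\<And>i. i < nr P \<Longrightarrow>
      (\<lambda>j. ineq P i xs j + rows_mult_vec (Dg P i xs) d j) \<in> soc_int (sz P i)"
    and Dhd: "\<And>i. i < np P \<Longrightarrow> Dh P xs i \<bullet> d = 0"
    and rank: "dim (Dh P xs ` {..<np P}) = np P"
    using rob by (auto simp: robinson_CQ_def rows_mult_vec_def)
  define M where "M k = (\<Sum>i<np P. \<bar>\<mu> k i\<bar>)" for k
  define \<Omega> where "\<Omega> k = (\<Sum>i<nr P. \<omega> k i 0)" for k
  define g where "g k = gradient (objf P) (x k) - gradient (lagrangian P (\<mu> k) (\<omega> k)) (x k)" for k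
  define H where "H k = (\<Sum>i<np P. \<mu> k i *\<^sub>R Dh P (x k) i)" for k
  define N where "N k = (\<Sum>i<nr P. transp_mult_vec (sz P i) (Dg P i (x k)) (\<omega> k i))" for k
  have stat: "N k = g k + H k" for k
    by (simp add: N_def g_def H_def lagrangian_gradient[OF socp] transp_mult_vec_def)
  have g: "g \<longlonglongrightarrow> gradient (objf P) xs"
    unfolding g_def using tendsto_diff[OF data(1) G0] by simp
  have \<omega>0: "\<omega> k i 0 \<ge> 0" if "i < nr P" for k i
    using soc_entry_le[OF cone[OF that], of 0] sz[OF that]
    by (meson abs_ge_zero less_le_trans order_trans zero_less_one)
  have \<Omega>0: "\<Omega> k \<ge> 0" for k
    unfolding \<Omega>_def using \<omega>0 by (auto intro: sum_nonneg)

  \<comment> \<open>The cone multipliers control the equality multipliers.\<close>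
  have "card (Dh P xs ` {..<np P}) \<le> np P"
    using card_image_le[of "{..<np P}" "Dh P xs"] by simp
  moreover have "dim (Dh P xs ` {..<np P}) \<le> card (Dh P xs ` {..<np P})"
    by (intro dim_le_card span_superset) auto
  ultimately have card: "card (Dh P xs ` {..<np P}) = np P"
    using rank by simp
  then have "inj_on (Dh P xs) {..<np P}"
    by (intro eq_card_imp_inj_on) auto
  moreover have "independent (Dh P xs ` {..<np P})"
    using card rank by (intro card_le_dim_spanning[of _ "Dh P xs ` {..<np P}"] span_superset) auto
  ultimately obtain K where K: "K > 0"
    "\<forall>\<^sub>F k in sequentially. \<forall>c. (\<Sum>i<np P. \<bar>c i\<bar>) \<le> K * norm (\<Sum>i<np P. c i *\<^sub>R Dh P (x k) i)"
    using perturbed_coefficients_bounded[of "{..<np P}" "Dh P xs" "\<lambda>k. Dh P (x k)" sequentially]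
      data(2) by auto
  define S where "S k = (\<Sum>i<nr P. \<Sum>j<sz P i. norm (Dg P i (x k) j))" for k
  define C where "C = (\<Sum>i<nr P. \<Sum>j<sz P i. norm (Dg P i xs j)) + 1"
  have "S \<longlonglongrightarrow> (\<Sum>i<nr P. \<Sum>j<sz P i. norm (Dg P i xs j))"
    unfolding S_def by (intro tendsto_intros data(4)) auto
  then have S: "\<forall>\<^sub>F k in sequentially. S k < C"
    by (rule order_tendstoD) (simp add: C_def)
  have C0: "C > 0"
    unfolding C_def by (intro add_nonneg_pos sum_nonneg) auto
  have normN: "norm (N k) \<le> \<Omega> k * S k" for k
  proof -
    have "norm (N k) \<le> (\<Sum>i<nr P. \<omega> k i 0 * S k)"
      unfolding N_def
    proof (rule sum_norm_le)
      fix i assume i: "i \<in> {..<nr P}"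
      have "norm (transp_mult_vec (sz P i) (Dg P i (x k)) (\<omega> k i))
          \<le> (\<Sum>j<sz P i. \<omega> k i 0 * norm (Dg P i (x k) j))"
        unfolding transp_mult_vec_def
      proof (rule sum_norm_le)
        fix j assume "j \<in> {..<sz P i}"
        then have "\<bar>\<omega> k i j\<bar> \<le> \<omega> k i 0"
          using soc_entry_le[OF cone, of i j k] i by simp
        then show "norm (\<omega> k i j *\<^sub>R Dg P i (x k) j) \<le> \<omega> k i 0 * norm (Dg P i (x k) j)"
          unfolding norm_scaleR by (rule mult_right_mono) simp
      qed
      also have "\<dots> = \<omega> k i 0 * (\<Sum>j<sz P i. norm (Dg P i (x k) j))"
        by (simp add: sum_distrib_left)
      also have "\<dots> \<le> \<omega> k i 0 * S k"
        unfolding S_def using i \<omega>0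
        by (intro mult_left_mono member_le_sum[where f = "\<lambda>i. \<Sum>j<sz P i. norm (Dg P i (x k) j)"])
          (auto intro: sum_nonneg)
      finally show "norm (transp_mult_vec (sz P i) (Dg P i (x k)) (\<omega> k i)) \<le> \<omega> k i 0 * S k" .
    qed
    then show ?thesis by (simp add: \<Omega>_def sum_distrib_right)
  qed
  define c where "c = norm (gradient (objf P) xs) + 1"
  have c: "\<forall>\<^sub>F k in sequentially. norm (g k) < c"
    using tendsto_norm[OF g] by (rule order_tendstoD) (simp add: c_def)
  have M: "\<forall>\<^sub>F k in sequentially. M k \<le> K * (c + \<Omega> k * C)"
    using K(2) S c
  proof eventually_elim
    case (elim k)
    have "norm (H k) = norm (N k - g k)"
      by (simp add: stat)
    also have "\<dots> \<le> norm (N k) + norm (g k)"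
      by (rule norm_triangle_ineq4)
    also have "\<dots> \<le> \<Omega> k * S k + c"
      using normN[of k] elim(3) by simp
    also have "\<dots> \<le> \<Omega> k * C + c"
      using elim(2) \<Omega>0[of k] by (simp add: mult_left_mono)
    finally have "K * norm (H k) \<le> K * (c + \<Omega> k * C)"
      using K(1) by simp
    moreover have "M k \<le> K * norm (H k)"
      unfolding M_def H_def using elim(1) by blast
    ultimately show ?case by linarith
  qed

  \<comment> \<open>Pairing stationarity with the Robinson direction controls the cone multipliers up to a
    small multiple of the equality multipliers.\<close>
  define w where "w k i = (\<lambda>j. ineq P i (x k) j + rows_mult_vec (Dg P i (x k)) d j)" for k i
  define v where "v i = (\<lambda>j. ineq P i xs j + rows_mult_vec (Dg P i xs) d j)" for i
  define s where "s i = v i 0 - tail_norm (sz P i) (v i)" for i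
  define \<epsilon> where "\<epsilon> = Min (insert 1 (s ` {..<nr P})) / 2"
  have spos: "s i > 0" if "i < nr P" for i
    using int[OF that] by (simp add: s_def v_def soc_int_def)
  then have "Min (insert 1 (s ` {..<nr P})) > 0"
    by (subst Min_gr_iff) auto
  then have \<epsilon>0: "\<epsilon> > 0" by (simp add: \<epsilon>_def)
  have \<epsilon>s: "\<epsilon> < s i" if "i < nr P" for i
  proof -
    have "Min (insert 1 (s ` {..<nr P})) \<le> s i"
      using that by (intro Min_le) auto
    then show ?thesis using spos[OF that] by (simp add: \<epsilon>_def)
  qed
  have "\<forall>\<^sub>F k in sequentially. \<forall>i\<in>{..<nr P}. \<epsilon> < w k i 0 - tail_norm (sz P i) (w k i)"
  proof (intro eventually_ball_finite ballI)
    fix i assume "i \<in> {..<nr P}"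
    then have i: "i < nr P" by simp
    have lim: "(\<lambda>k. w k i j) \<longlonglongrightarrow> v i j" if "j < sz P i" for j
      unfolding w_def v_def rows_mult_vec_def using i that by (intro tendsto_intros data)
    have "(\<lambda>k. w k i 0 - tail_norm (sz P i) (w k i)) \<longlonglongrightarrow> s i"
      unfolding s_def using sz[OF i] by (intro tendsto_intros lim tail_norm_tendsto) auto
    then show "\<forall>\<^sub>F k in sequentially. \<epsilon> < w k i 0 - tail_norm (sz P i) (w k i)"
      using \<epsilon>s[OF i] by (rule order_tendstoD)
  qed simp
  moreover define R where
    "R k = (\<Sum>i<nr P. inner_l (sz P i) (ineq P i (x k)) (\<omega> k i)) + g k \<bullet> d" for k
  moreover define T where "T k = (\<Sum>i<np P. \<bar>Dh P (x k) i \<bullet> d\<bar>)" for k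
  ultimately have W: "\<forall>\<^sub>F k in sequentially. \<epsilon> * \<Omega> k \<le> R k + M k * T k"
  proof (elim eventually_mono)
    fix k
    assume \<epsilon>: "\<forall>i\<in>{..<nr P}. \<epsilon> < w k i 0 - tail_norm (sz P i) (w k i)"
    have "\<epsilon> * \<Omega> k = (\<Sum>i<nr P. \<epsilon> * \<omega> k i 0)"
      by (simp add: \<Omega>_def sum_distrib_left)
    also have "\<dots> \<le> (\<Sum>i<nr P. inner_l (sz P i) (w k i) (\<omega> k i))"
    proof (rule sum_mono)
      fix i assume i: "i \<in> {..<nr P}"
      then have "\<epsilon> * \<omega> k i 0 \<le> (w k i 0 - tail_norm (sz P i) (w k i)) * \<omega> k i 0"
        using \<epsilon> \<omega>0 by (intro mult_right_mono) (auto intro: less_imp_le)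
      also have "\<dots> \<le> inner_l (sz P i) (w k i) (\<omega> k i)"
        using i cone sz by (intro inner_soc_lower_bound) auto
      finally show "\<epsilon> * \<omega> k i 0 \<le> inner_l (sz P i) (w k i) (\<omega> k i)" .
    qed
    also have "\<dots> = (\<Sum>i<nr P. inner_l (sz P i) (ineq P i (x k)) (\<omega> k i)) + N k \<bullet> d"
      by (simp add: N_def w_def inner_l_def transp_mult_vec_def rows_mult_vec_def inner_sum_left
          algebra_simps sum.distrib)
    also have "\<dots> = R k + H k \<bullet> d"
      by (simp add: R_def stat inner_add_left)
    also have "H k \<bullet> d \<le> (\<Sum>i<np P. \<bar>\<mu> k i\<bar> * T k)"
      unfolding H_def inner_sum_left
    proof (rule sum_mono)
      fix i assume i: "i \<in> {..<np P}"
      have "\<mu> k i *\<^sub>R Dh P (x k) i \<bullet> d \<le> \<bar>\<mu> k i\<bar> * \<bar>Dh P (x k) i \<bullet> d\<bar>"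
        by (metis abs_ge_self abs_mult inner_scaleR_left)
      also have "\<dots> \<le> \<bar>\<mu> k i\<bar> * T k"
        unfolding T_def using i
        by (intro mult_left_mono member_le_sum[where f = "\<lambda>i. \<bar>Dh P (x k) i \<bullet> d\<bar>"]) auto
      finally show "\<mu> k i *\<^sub>R Dh P (x k) i \<bullet> d \<le> \<bar>\<mu> k i\<bar> * T k" .
    qed
    also have "(\<Sum>i<np P. \<bar>\<mu> k i\<bar> * T k) = M k * T k"
      by (simp add: M_def sum_distrib_right)
    finally show "\<epsilon> * \<Omega> k \<le> R k + M k * T k" by simp
  qed
  define \<rho> where "\<rho> = \<bar>gradient (objf P) xs \<bullet> d\<bar> + 1"
  have "R \<longlonglongrightarrow> (\<Sum>i<nr P. 0) + gradient (objf P) xs \<bullet> d"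
    unfolding R_def by (intro tendsto_intros compl g) auto
  then have R: "\<forall>\<^sub>F k in sequentially. R k < \<rho>"
    by (rule order_tendstoD) (simp add: \<rho>_def)
  \<comment> \<open>With this threshold the feedback of the two estimates into each other costs only half of
    the coercivity constant.\<close>
  define \<tau> where "\<tau> = \<epsilon> / (2 * K * C)"
  have \<tau>0: "\<tau> > 0" using \<epsilon>0 K(1) C0 by (simp add: \<tau>_def)
  have "T \<longlonglongrightarrow> (\<Sum>i<np P. \<bar>Dh P xs i \<bullet> d\<bar>)"
    unfolding T_def by (intro tendsto_intros data(2)) auto
  then have T: "\<forall>\<^sub>F k in sequentially. T k < \<tau>"
    by (rule order_tendstoD) (use \<tau>0 Dhd in simp)
  define B where "B = 2 * (\<rho> + \<tau> * K * c) / \<epsilon>"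
  have "\<forall>\<^sub>F k in sequentially. M k \<le> max B (K * (c + B * C)) \<and> \<Omega> k \<le> max B (K * (c + B * C))"
    using M W R T
  proof eventually_elim
    case (elim k)
    have "M k \<ge> 0" unfolding M_def by (simp add: sum_nonneg)
    then have "M k * T k \<le> M k * \<tau>"
      using elim(4) by (intro mult_left_mono) auto
    also have "\<dots> \<le> K * (c + \<Omega> k * C) * \<tau>"
      using elim(1) \<tau>0 by (intro mult_right_mono) auto
    also have "\<dots> = \<tau> * K * c + \<Omega> k * (\<epsilon> / 2)"
      using K(1) C0 by (simp add: \<tau>_def field_simps)
    finally have "\<epsilon> * \<Omega> k \<le> \<rho> + \<tau> * K * c + \<Omega> k * (\<epsilon> / 2)"
      using elim(2,3) by linarith
    then have "\<Omega> k \<le> B"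
      using \<epsilon>0 by (simp add: B_def field_simps)
    moreover from this have "K * (c + \<Omega> k * C) \<le> K * (c + B * C)"
      using K(1) C0 by simp
    ultimately show ?case using elim(1) by auto
  qed
  then show ?thesis unfolding M_def \<Omega>_def by blast
qed

section \<open>Passage to the limit\<close>

lemma CAKKT_seq_convergent_multipliers:
  assumes socp: "is_socp P" and rob: "robinson_CQ P xs" and seq: "CAKKT_seq P xs x \<mu> \<omega>"
  shows "\<exists>r m w. strict_mono (r :: nat \<Rightarrow> nat) \<and> (\<forall>i<np P. (\<lambda>k. \<mu> (r k) i) \<longlonglongrightarrow> m i) \<and>
    (\<forall>i<nr P. \<forall>j<sz P i. (\<lambda>k. \<omega> (r k) i j) \<longlonglongrightarrow> w i j)"
proof -
  obtain B where B: "\<forall>\<^sub>F k in sequentially. (\<Sum>i<np P. \<bar>\<mu> k i\<bar>) \<le> B \<and> (\<Sum>i<nr P. \<omega> k i 0) \<le> B"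
    using robinson_multipliers_bounded[OF assms] by blast
  have cone: "\<And>k i. i < nr P \<Longrightarrow> \<omega> k i \<in> soc (sz P i)"
    using seq by (auto simp: CAKKT_seq_def Kcone_def)
  have "Bseq (\<lambda>k. \<mu> k i)" if "i < np P" for i
  proof (rule BfunI)
    show "\<forall>\<^sub>F k in sequentially. norm (\<mu> k i) \<le> B"
      using B
    proof eventually_elim
      case (elim k)
      have "\<bar>\<mu> k i\<bar> \<le> (\<Sum>i<np P. \<bar>\<mu> k i\<bar>)"
        using that by (intro member_le_sum) auto
      with elim show ?case by simp
    qed
  qed
  moreover have "Bseq (\<lambda>k. \<omega> k i j)" if "i < nr P" "j < sz P i" for i j
  proof (rule BfunI)
    show "\<forall>\<^sub>F k in sequentially. norm (\<omega> k i j) \<le> B"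
      using B
    proof eventually_elim
      case (elim k)
      have "0 \<le> \<omega> k i 0" if "i < nr P" for i
        using cone[OF that, of k] by (auto simp: soc_def tail_norm_L2 intro: order_trans[OF L2_set_nonneg])
      then have "\<omega> k i 0 \<le> (\<Sum>i<nr P. \<omega> k i 0)"
        using that(1) by (intro member_le_sum) auto
      moreover have "\<bar>\<omega> k i j\<bar> \<le> \<omega> k i 0"
        using soc_entry_le[OF cone[OF that(1)] that(2)] .
      ultimately show ?case using elim by simp
    qed
  qed
  \<comment> \<open>One family over a disjoint sum, so that a single extraction serves both kinds of
    multipliers.\<close>
  ultimately have "Bseq (\<lambda>k. case_sum (\<mu> k) (\<lambda>(i, j). \<omega> k i j) e)"
    if "e \<in> {..<np P} <+> (SIGMA i:{..<nr P}. {..<sz P i})" for e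
    using that by auto
  then obtain r l where r: "strict_mono (r :: nat \<Rightarrow> nat)"
    and l: "\<And>e. e \<in> {..<np P} <+> (SIGMA i:{..<nr P}. {..<sz P i}) \<Longrightarrow>
      (\<lambda>k. case_sum (\<mu> (r k)) (\<lambda>(i, j). \<omega> (r k) i j) e) \<longlonglongrightarrow> l e"
    using convergent_subsequence_finite_family[of
        "{..<np P} <+> (SIGMA i:{..<nr P}. {..<sz P i})"
        "\<lambda>k. case_sum (\<mu> k) (\<lambda>(i, j). \<omega> k i j)"] by auto
  have "(\<lambda>k. \<mu> (r k) i) \<longlonglongrightarrow> l (Inl i)" if "i < np P" for i
    using l[of "Inl i"] that by auto
  moreover have "(\<lambda>k. \<omega> (r k) i j) \<longlonglongrightarrow> l (Inr (i, j))" if "i < nr P" "j < sz P i" for i j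
    using l[of "Inr (i, j)"] that by auto
  ultimately show ?thesis
    using r by (intro exI[of _ r] exI[of _ "\<lambda>i. l (Inl i)"] exI[of _ "\<lambda>i j. l (Inr (i, j))"]) auto
qed

lemma CAKKT_seq_subseq:
  assumes "CAKKT_seq P xs x \<mu> \<omega>" and "strict_mono r"
  shows "CAKKT_seq P xs (\<lambda>k. x (r k)) (\<lambda>k. \<mu> (r k)) (\<lambda>k. \<omega> (r k))"
proof -
  have sub: "(\<lambda>k. f (r k)) \<longlonglongrightarrow> l" if "f \<longlonglongrightarrow> l" for f :: "nat \<Rightarrow> 'b::topological_space" and l
    using LIMSEQ_subseq_LIMSEQ[OF that assms(2)] by (simp add: o_def)
  show ?thesis
    unfolding CAKKT_seq_def
  proof (intro conjI allI impI)
    show "feasible P xs" and "\<And>k. \<omega> (r k) \<in> Kcone P"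
      using assms(1) by (auto simp: CAKKT_seq_def)
    show "(\<lambda>k. x (r k)) \<longlonglongrightarrow> xs"
      using assms(1) by (intro sub[of x]) (simp add: CAKKT_seq_def)
    show "(\<lambda>k. gradient (lagrangian P (\<mu> (r k)) (\<omega> (r k))) (x (r k))) \<longlonglongrightarrow> 0"
      using assms(1)
      by (intro sub[of "\<lambda>k. gradient (lagrangian P (\<mu> k) (\<omega> k)) (x k)"]) (simp add: CAKKT_seq_def)
    show "(\<lambda>k. jordan_prod (sz P i) (ineq P i (x (r k))) (\<omega> (r k) i) j) \<longlonglongrightarrow> 0"
      if "i < nr P" "j < sz P i" for i j
      using assms(1) that
      by (intro sub[of "\<lambda>k. jordan_prod (sz P i) (ineq P i (x k)) (\<omega> k i) j"])
        (simp add: CAKKT_seq_def)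
    show "(\<lambda>k. eqh P (x (r k)) i * \<mu> (r k) i) \<longlonglongrightarrow> 0" if "i < np P" for i
      using assms(1) that by (intro sub[of "\<lambda>k. eqh P (x k) i * \<mu> k i"]) (simp add: CAKKT_seq_def)
  qed
qed

context
  fixes P :: "('n::finite) socp" and x :: "nat \<Rightarrow> real^'n" and xs :: "real^'n"
    and \<mu> :: "nat \<Rightarrow> nat \<Rightarrow> real" and \<omega> :: "nat \<Rightarrow> nat \<Rightarrow> nat \<Rightarrow> real"
    and m :: "nat \<Rightarrow> real" and w :: "nat \<Rightarrow> nat \<Rightarrow> real"
  assumes socp: "is_socp P" and X: "x \<longlonglongrightarrow> xs"
    and m: "\<And>i. i < np P \<Longrightarrow> (\<lambda>k. \<mu> k i) \<longlonglongrightarrow> m i"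
    and w: "\<And>i j. i < nr P \<Longrightarrow> j < sz P i \<Longrightarrow> (\<lambda>k. \<omega> k i j) \<longlonglongrightarrow> w i j"
begin

lemma lagrangian_gradient_tendsto:
  "(\<lambda>k. gradient (lagrangian P (\<mu> k) (\<omega> k)) (x k)) \<longlonglongrightarrow> gradient (lagrangian P m w) xs"
  unfolding lagrangian_gradient[OF socp] transp_mult_vec_def
  by (intro tendsto_intros socp_data_tendsto[OF socp X] m w) auto

lemma lagrangian_hessian_tendsto:
  "(\<lambda>k. hessian (lagrangian P (\<mu> k) (\<omega> k)) (x k)) \<longlonglongrightarrow> hessian (lagrangian P m w) xs"
proof -
  have "(\<lambda>k. hessian (objf P) (x k)) \<longlonglongrightarrow> hessian (objf P) xs"
    and "\<And>i. i < np P \<Longrightarrow>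
      (\<lambda>k. hessian (\<lambda>y. eqh P y i) (x k)) \<longlonglongrightarrow> hessian (\<lambda>y. eqh P y i) xs"
    and "\<And>i j. i < nr P \<Longrightarrow> j < sz P i \<Longrightarrow>
      (\<lambda>k. hessian (\<lambda>y. ineq P i y j) (x k)) \<longlonglongrightarrow> hessian (\<lambda>y. ineq P i y j) xs"
    using socp X unfolding is_socp_def by (auto intro: twice_cont_diff_tendsto(3))
  then show ?thesis
    unfolding lagrangian_hessian[OF socp] by (intro tendsto_intros m w) auto
qed

lemma sigma_tendsto: "(\<lambda>k. sigma P xs (x k) (\<omega> k)) \<longlonglongrightarrow> sigma P xs xs w"
  unfolding sigma_def
proof (rule tendsto_sum)
  fix i assume "i \<in> IB P xs"
  then have i: "i < nr P" and nz: "ineq P i xs 0 \<noteq> 0"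
    by (auto simp: IB_def soc_bd_plus_def)
  have sz: "0 < sz P i" using socp i by (auto simp: is_socp_def Suc_le_eq)
  have "(\<lambda>k. Gam (Dg P i (x k)) j) \<longlonglongrightarrow> Gam (Dg P i xs) j" if "j < sz P i" for j
    using socp_data_tendsto(4)[OF socp X i that] by (auto simp: Gam_def intro: tendsto_minus)
  then have "(\<lambda>k. transp_mult (sz P i) (Dg P i (x k)) (Gam (Dg P i (x k))))
      \<longlonglongrightarrow> transp_mult (sz P i) (Dg P i xs) (Gam (Dg P i xs))"
    unfolding transp_mult_def
    by (intro tendsto_sum outer_tendsto socp_data_tendsto[OF socp X] i) auto
  then show "(\<lambda>k. - (\<omega> k i 0 / ineq P i (x k) 0) *\<^sub>R
        transp_mult (sz P i) (Dg P i (x k)) (Gam (Dg P i (x k))))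
      \<longlonglongrightarrow> - (w i 0 / ineq P i xs 0) *\<^sub>R transp_mult (sz P i) (Dg P i xs) (Gam (Dg P i xs))"
    by (intro tendsto_intros w socp_data_tendsto[OF socp X] i sz nz)
qed

lemma CAKKT_limit_KKT:
  assumes seq: "CAKKT_seq P xs x \<mu> \<omega>"
  shows "KKT_triple P xs m w"
  unfolding KKT_triple_def
proof (intro conjI allI impI)
  have sz: "sz P i \<ge> 1" if "i < nr P" for i
    using socp that by (simp add: is_socp_def)
  show "w \<in> Kcone P"
  proof (rule Kcone_limit)
    show "\<omega> k \<in> Kcone P" for k using seq by (simp add: CAKKT_seq_def)
  qed (fact sz w)+
  show "feasible P xs" using seq by (simp add: CAKKT_seq_def)
  show "gradient (lagrangian P m w) xs = 0"
    using seq lagrangian_gradient_tendsto LIMSEQ_unique by (auto simp: CAKKT_seq_def)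
  fix i assume i: "i < nr P"
  have "(\<lambda>k. jordan_prod (sz P i) (ineq P i (x k)) (\<omega> k i) 0) \<longlonglongrightarrow> 0"
    using seq sz[OF i] i unfolding CAKKT_seq_def by (meson less_le_trans zero_less_one)
  then have "(\<lambda>k. inner_l (sz P i) (ineq P i (x k)) (\<omega> k i)) \<longlonglongrightarrow> 0"
    by (simp add: jordan_prod_def)
  moreover have "(\<lambda>k. inner_l (sz P i) (ineq P i (x k)) (\<omega> k i))
      \<longlonglongrightarrow> inner_l (sz P i) (ineq P i xs) (w i)"
    unfolding inner_l_def using i by (intro tendsto_intros w socp_data_tendsto[OF socp X]) auto
  ultimately show "inner_l (sz P i) (ineq P i xs) (w i) = 0"
    using LIMSEQ_unique by blast
qed

end

lemma bd_grad_tendsto: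
  assumes socp: "is_socp P" and X: "(x \<longlongrightarrow> xs) F" and i: "i < nr P"
  shows "((\<lambda>k. bd_grad P i (x k)) \<longlongrightarrow> bd_grad P i xs) F"
proof -
  have "((\<lambda>k. Gam (tilde (sz P i) (ineq P i (x k))) j)
      \<longlongrightarrow> Gam (tilde (sz P i) (ineq P i xs)) j) F" if "j < sz P i" for j
    using that socp_data_tendsto(3)[OF socp X i]
    by (auto simp: Gam_def tilde_def intro: tail_norm_tendsto tendsto_minus)
  then show ?thesis
    unfolding bd_grad_def transp_mult_vec_def
    by (intro tendsto_intros socp_data_tendsto[OF socp X] i) auto
qed

text \<open>
  At the reference point the members of the constant rank family are exactly the vectors defining
  the critical subspace, so the approximation lemma applies.
\<close>

lemma WCR_approximate_critical_direction:
  assumes socp: "is_socp P" and wcr: "WCR P xs" and X: "x \<longlonglongrightarrow> xs" and d: "d \<in> crit_subspace P xs"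
  shows "\<exists>D. D \<longlonglongrightarrow> d \<and> (\<forall>k. \<forall>v\<in>wcr_family P xs (x k). v \<bullet> D k = 0)"
proof -
  \<comment> \<open>Indexing by the vector fields themselves makes the family at \<open>y\<close> the image of \<open>A\<close> under
    evaluation at \<open>y\<close>, so its three parts need no separate treatment.\<close>
  define A where "A = (\<lambda>i y. Dh P y i) ` {..<np P} \<union>
    (\<lambda>(i, j) y. Dg P i y j) ` (SIGMA i:I0 P xs. {..<sz P i}) \<union> bd_grad P ` IB P xs"
  have fam: "wcr_family P xs y = (\<lambda>\<phi>. \<phi> y) ` A" for y
    unfolding wcr_family_def A_def image_Un image_image by (auto simp: image_iff split_beta) blast
  have I0: "I0 P xs \<subseteq> {..<nr P}" and IB: "IB P xs \<subseteq> {..<nr P}"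
    by (auto simp: I0_def IB_def)
  have fin: "finite A"
    unfolding A_def using finite_subset[OF I0] finite_subset[OF IB] by auto
  have lim: "(\<lambda>k. \<phi> (x k)) \<longlonglongrightarrow> \<phi> xs" if "\<phi> \<in> A" for \<phi>
    using that I0 IB unfolding A_def
    by (auto intro: socp_data_tendsto[OF socp X] bd_grad_tendsto[OF socp X])
  obtain N where N: "open N" "xs \<in> N"
    "\<And>y. y \<in> N \<Longrightarrow> dim (wcr_family P xs y) = dim (wcr_family P xs xs)"
    using wcr by (auto simp: WCR_def)
  have "\<forall>\<^sub>F k in sequentially. x k \<in> N"
    using X N(1,2) by (rule topological_tendstoD)
  then have rank: "\<forall>\<^sub>F k in sequentially. dim ((\<lambda>\<phi>. \<phi> (x k)) ` A) = dim ((\<lambda>\<phi>. \<phi> xs) ` A)"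
    by (rule eventually_mono) (use N(3) fam in simp)
  have orth: "\<phi> xs \<bullet> d = 0" if "\<phi> \<in> A" for \<phi>
    using that d unfolding A_def crit_subspace_def
    by (auto simp: bd_grad_at_boundary) (auto simp: rows_mult_vec_def)
  show ?thesis
    using constant_rank_orthogonal_approximation[of A "\<lambda>k \<phi>. \<phi> (x k)" "\<lambda>\<phi>. \<phi> xs" d] fin lim rank orth
    by (simp add: fam)
qed

lemma penalty_terms_vanish:
  assumes "\<And>v. v \<in> wcr_family P xs y \<Longrightarrow> v \<bullet> d = 0"
  shows "(H + (\<Sum>i<np P. \<eta> i *\<^sub>R outer (Dh P y i) (Dh P y i))
      + (\<Sum>i\<in>IB P xs. \<gamma> i *\<^sub>R outer (bd_grad P i y) (bd_grad P i y))
      + (\<Sum>i\<in>I0 P xs. \<theta> i *\<^sub>R transp_mult (sz P i) (Dg P i y) (Dg P i y))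
      + \<delta> *\<^sub>R mat 1) *v d = (H + \<delta> *\<^sub>R mat 1) *v d"
proof -
  have "Dh P y i \<bullet> d = 0" if "i < np P" for i
    using that by (intro assms) (auto simp: wcr_family_def)
  moreover have "bd_grad P i y \<bullet> d = 0" if "i \<in> IB P xs" for i
    using that by (intro assms) (auto simp: wcr_family_def)
  moreover have "Dg P i y j \<bullet> d = 0" if "i \<in> I0 P xs" "j < sz P i" for i j
    using that by (intro assms) (auto simp: wcr_family_def)
  ultimately show ?thesis
    by (simp add: matrix_vector_mult_add_rdistrib sum_matrix_vector_mult outer_mult_vec
        transp_mult_mult_vec scaleR_matrix_vector_assoc[symmetric])
qed

theorem mainTheorem4:
  fixes P :: "('n::finite) socp" and xs :: "real^'n"
  assumes "is_socp P"
    and "CAKKT2 P xs"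
    and "robinson_CQ P xs"
    and "WCR P xs"
  shows "\<exists>(\<mu> :: nat \<Rightarrow> real) (\<omega> :: nat \<Rightarrow> nat \<Rightarrow> real). \<omega> \<in> Kcone P \<and> WSONC P xs \<mu> \<omega>"
proof -
  let ?M = "\<lambda>x \<mu> \<omega> \<eta> \<theta> \<gamma> \<delta>. hessian (lagrangian P \<mu> \<omega>) x + sigma P xs x \<omega>
    + (\<Sum>i<np P. \<eta> i *\<^sub>R outer (Dh P x i) (Dh P x i))
    + (\<Sum>i\<in>IB P xs. \<gamma> i *\<^sub>R outer (bd_grad P i x) (bd_grad P i x))
    + (\<Sum>i\<in>I0 P xs. \<theta> i *\<^sub>R transp_mult (sz P i) (Dg P i x) (Dg P i x))
    + \<delta> *\<^sub>R mat 1"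
  from assms(2) obtain x0 \<mu>0 \<omega>0 \<eta>0 \<theta>0 \<gamma>0 \<delta>0 where
    seq0: "CAKKT_seq P xs x0 \<mu>0 \<omega>0" and \<delta>0: "\<delta>0 \<longlonglongrightarrow> 0"
    and second0: "\<forall>\<^sub>F k in sequentially. \<forall>d.
      d \<bullet> (?M (x0 k) (\<mu>0 k) (\<omega>0 k) (\<eta>0 k) (\<theta>0 k) (\<gamma>0 k) (\<delta>0 k) *v d) \<ge> 0"
    unfolding CAKKT2_def by blast
  obtain r m w where r: "strict_mono (r :: nat \<Rightarrow> nat)"
    and m: "\<And>i. i < np P \<Longrightarrow> (\<lambda>k. \<mu>0 (r k) i) \<longlonglongrightarrow> m i"
    and w: "\<And>i j. i < nr P \<Longrightarrow> j < sz P i \<Longrightarrow> (\<lambda>k. \<omega>0 (r k) i j) \<longlonglongrightarrow> w i j"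
    using CAKKT_seq_convergent_multipliers[OF assms(1,3) seq0] by blast
  define x where "x k = x0 (r k)" for k
  define \<mu> where "\<mu> k = \<mu>0 (r k)" for k
  define \<omega> where "\<omega> k = \<omega>0 (r k)" for k
  have seq: "CAKKT_seq P xs x \<mu> \<omega>"
    unfolding x_def \<mu>_def \<omega>_def by (rule CAKKT_seq_subseq[OF seq0 r])
  then have X: "x \<longlonglongrightarrow> xs" by (simp add: CAKKT_seq_def)
  have \<delta>: "(\<lambda>k. \<delta>0 (r k)) \<longlonglongrightarrow> 0"
    using LIMSEQ_subseq_LIMSEQ[OF \<delta>0 r] by (simp add: o_def)
  have second: "\<forall>\<^sub>F k in sequentially. \<forall>d.
      d \<bullet> (?M (x k) (\<mu> k) (\<omega> k) (\<eta>0 (r k)) (\<theta>0 (r k)) (\<gamma>0 (r k)) (\<delta>0 (r k)) *v d) \<ge> 0"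
    unfolding x_def \<mu>_def \<omega>_def by (rule eventually_subseq[OF r second0])
  note limits = assms(1) X m[folded \<mu>_def] w[folded \<omega>_def]
  have KKT: "KKT_triple P xs m w"
    by (rule CAKKT_limit_KKT[where x = x and \<mu> = \<mu> and \<omega> = \<omega>]) (fact limits seq)+
  moreover have "d \<bullet> ((hessian (lagrangian P m w) xs + sigma P xs xs w) *v d) \<ge> 0"
    if d: "d \<in> crit_subspace P xs" for d
  proof -
    obtain D where D: "D \<longlonglongrightarrow> d" and orth: "\<And>k v. v \<in> wcr_family P xs (x k) \<Longrightarrow> v \<bullet> D k = 0"
      using WCR_approximate_critical_direction[OF assms(1,4) X d] by blast
    let ?H = "\<lambda>k. hessian (lagrangian P (\<mu> k) (\<omega> k)) (x k) + sigma P xs (x k) (\<omega> k) + \<delta>0 (r k) *\<^sub>R mat 1"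
    have "?H \<longlonglongrightarrow> hessian (lagrangian P m w) xs + sigma P xs xs w + 0 *\<^sub>R mat 1"
      by (intro tendsto_intros lagrangian_hessian_tendsto[OF limits] sigma_tendsto[OF limits] \<delta>)
    then have "?H \<longlonglongrightarrow> hessian (lagrangian P m w) xs + sigma P xs xs w"
      by simp
    from quadratic_form_tendsto[OF this D]
    have "(\<lambda>k. D k \<bullet> (?H k *v D k))
        \<longlonglongrightarrow> d \<bullet> ((hessian (lagrangian P m w) xs + sigma P xs xs w) *v d)" .
    moreover have "\<forall>\<^sub>F k in sequentially. 0 \<le> D k \<bullet> (?H k *v D k)"
      using second
    proof eventually_elim
      case (elim k)
      then have "0 \<le> D k \<bullet> (?M (x k) (\<mu> k) (\<omega> k) (\<eta>0 (r k)) (\<theta>0 (r k)) (\<gamma>0 (r k)) (\<delta>0 (r k)) *v D k)"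
        by blast
      then show ?case
        by (simp only: penalty_terms_vanish[OF orth])
    qed
    ultimately show ?thesis
      by (rule tendsto_lowerbound) simp
  qed
  ultimately show ?thesis
    unfolding WSONC_def by (metis KKT_triple_def)
qed

end
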